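(* Let $P \subset \mathbb{R}^d_+$ be an anti-blocking polytope with a triangulation $\mathcal{T}$. Then \[ \mathcal{U}\mathcal{T} \;:=\; \{ \sigma S : S \in \mathcal{T},\ \sigma \in \{-1,+1\}^d\} \] is a triangulation of $\mathcal{U}P$. Furthermore: (i) if $\mathcal{T}$ is unimodular, then so is $\mathcal{U}\mathcal{T}$; (ii) if $\mathcal{T}$ is regular, then so is $\mathcal{U}\mathcal{T}$; (iii) if $\mathcal{T}$ is flag, then so is $\mathcal{U}\mathcal{T}$.
   Context: A polytope $P\subset\mathbb{R}^d_+$ is anti-blocking if for every $\mathbf{q}\in P$ and every $\mathbf{p}\in\mathbb{R}^d$ with $0\le p_i\le q_i$ for all $i$, one has $\mathbf{p}\in P$. For $\sigma\in\{-1,+1\}^d$, $\sigma\mathbf{p}=(\sigma_1p_1,\dots,\sigma_dp_d)$ and $\sigma S = \{\sigma\mathbf{p}:\mathbf{p}\in S\}$. $\mathcal{U}P := \{\mathbf{p}\in\mathbb{R}^d : (|p_1|,\dots,|p_d|)\in P\}$. A triangulation of a $d$-polytope is a subdivision into $d$-simplices intersecting pairwise in common faces; it is unimodular if each simplex has normalized volume $1$ (vertices $v_0,\dots,v_d$ with $v_i-v_0$ a lattice basis of $\mathbb{Z}^d$); regular if it is induced as the projection of the lower faces of the lifted polytope $\mathrm{conv}((v,\omega(v)))$ for some height function $\omega$ on the vertices; flag if every inclusion-minimal non-face (a set of vertices of the triangulation whose convex hull is not a face of any simplex) has exactly two elements. *)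

theory Defs
  imports "HOL-Analysis.Analysis"
begin

definition anti_blocking :: "(real ^ 'n) set \<Rightarrow> bool" where
  "anti_blocking P \<longleftrightarrow>
     polytope P \<and>
     (\<forall>q\<in>P. \<forall>i. 0 \<le> q $ i) \<and>
     (\<forall>q\<in>P. \<forall>p. (\<forall>i. 0 \<le> p $ i \<and> p $ i \<le> q $ i) \<longrightarrow> p \<in> P)"

definition sign_vectors :: "(real ^ 'n) set" where
  "sign_vectors = {\<sigma>. \<forall>i. \<sigma> $ i \<in> {-1, 1}}"

definition sign_act :: "real ^ 'n \<Rightarrow> real ^ 'n \<Rightarrow> real ^ 'n" where
  "sign_act \<sigma> p = (\<chi> i. \<sigma> $ i * p $ i)"

definition unconditional :: "(real ^ 'n) set \<Rightarrow> (real ^ 'n) set" where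
  "unconditional P = {p. (\<chi> i. \<bar>p $ i\<bar>) \<in> P}"

definition unconditional_family :: "(real ^ 'n) set set \<Rightarrow> (real ^ 'n) set set" where
  "unconditional_family \<T> = {sign_act \<sigma> ` S | \<sigma> S. \<sigma> \<in> sign_vectors \<and> S \<in> \<T>}"

text \<open>The family contains only the top-dimensional simplices. The dimension is that of
  \<open>P\<close>, so that polytopes which are not full-dimensional are covered as well.\<close>

definition triangulation_of :: "(real ^ 'n) set set \<Rightarrow> (real ^ 'n) set \<Rightarrow> bool" where
  "triangulation_of \<T> P \<longleftrightarrow>
     polytope P \<and> triangulation \<T> \<and> (\<forall>S\<in>\<T>. aff_dim P simplex S) \<and> \<Union>\<T> = P"

definition vertices_of :: "(real ^ 'n) set set \<Rightarrow> (real ^ 'n) set" where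
  "vertices_of \<T> = {v. \<exists>S\<in>\<T>. v extreme_point_of S}"

definition lattice_basis :: "(real ^ 'n) set \<Rightarrow> bool" where
  "lattice_basis B \<longleftrightarrow>
     independent B \<and>
     {\<Sum>b\<in>B. of_int (c b) *\<^sub>R b | c :: real ^ 'n \<Rightarrow> int. True} = {x. \<forall>i. x $ i \<in> \<int>}"

definition unimodular_simplex :: "(real ^ 'n) set \<Rightarrow> bool" where
  "unimodular_simplex S \<longleftrightarrow>
     (\<exists>v\<^sub>0. v\<^sub>0 extreme_point_of S \<and>
        lattice_basis {v - v\<^sub>0 | v. v extreme_point_of S \<and> v \<noteq> v\<^sub>0})"

definition unimodular_triangulation :: "(real ^ 'n) set set \<Rightarrow> bool" where
  "unimodular_triangulation \<T> \<longleftrightarrow> (\<forall>S\<in>\<T>. unimodular_simplex S)"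

text \<open>A face is lower if it is cut out by a supporting hyperplane whose outer normal has
  negative last coordinate.\<close>

definition lower_face_of :: "((real ^ 'n) \<times> real) set \<Rightarrow> ((real ^ 'n) \<times> real) set \<Rightarrow> bool" where
  "lower_face_of F Q \<longleftrightarrow>
     (\<exists>a b. snd a < 0 \<and> Q \<subseteq> {y. a \<bullet> y \<le> b} \<and> F = Q \<inter> {y. a \<bullet> y = b})"

definition lifted_polytope ::
    "(real ^ 'n) set \<Rightarrow> (real ^ 'n \<Rightarrow> real) \<Rightarrow> ((real ^ 'n) \<times> real) set" where
  "lifted_polytope V \<omega> = convex hull ((\<lambda>v. (v, \<omega> v)) ` V)"

text \<open>Only lower faces of the dimension of the triangulated polytope are projected, because
  a triangulation is recorded by its top-dimensional simplices.\<close>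

definition regular_triangulation :: "(real ^ 'n) set set \<Rightarrow> bool" where
  "regular_triangulation \<T> \<longleftrightarrow>
     (\<exists>\<omega>. \<T> = {fst ` F | F. lower_face_of F (lifted_polytope (vertices_of \<T>) \<omega>) \<and>
                            aff_dim F = aff_dim (\<Union>\<T>)})"

definition non_face :: "(real ^ 'n) set set \<Rightarrow> (real ^ 'n) set \<Rightarrow> bool" where
  "non_face \<T> W \<longleftrightarrow>
     W \<subseteq> vertices_of \<T> \<and> \<not> (\<exists>S\<in>\<T>. convex hull W face_of S)"

definition flag_triangulation :: "(real ^ 'n) set set \<Rightarrow> bool" where
  "flag_triangulation \<T> \<longleftrightarrow>
     (\<forall>W. non_face \<T> W \<and> (\<forall>W'. W' \<subset> W \<longrightarrow> \<not> non_face \<T> W') \<longrightarrow> card W = 2)"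

end

theory Submission
  imports Defs
begin

text \<open>Reflections at coordinate hyperplanes are injective linear maps preserving the integer
  lattice, and a point common to the positive orthant and its reflection by \<open>\<sigma>\<close> is fixed by
  \<open>\<sigma>\<close>. Hence two reflected simplices meet, up to reflection, in a common face of two original
  simplices cut down by coordinate hyperplanes, which support the positive orthant. For regularity,
  a height function \<open>\<omega>\<close> for the given triangulation is extended to \<open>\<omega> \<bar>v\<bar> + K * (\<Sum>i. \<bar>v\<^sub>i\<bar>)\<close>:
  the second term is linear on every orthant, and for large \<open>K\<close> it folds the lifted surface
  convexly along the coordinate hyperplanes. For flagness, a set of vertices whose pairs are all
  faces lies in a single orthant.\<close>

section \<open>Sign changes\<close>

definition abs_vec :: "real ^ 'n \<Rightarrow> real ^ 'n" where
  "abs_vec p = (\<chi> i. \<bar>p $ i\<bar>)"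

text \<open>A zero coordinate gets sign 1, not the value 0 of \<open>sgn\<close>, so the result is
  always a sign vector.\<close>

definition signs_of :: "real ^ 'n \<Rightarrow> real ^ 'n" where
  "signs_of p = (\<chi> i. if p $ i < 0 then - 1 else 1)"

lemma sign_vectors_cases:
  assumes "\<sigma> \<in> sign_vectors"
  shows "\<sigma> $ i = - 1 \<or> \<sigma> $ i = 1"
  using assms by (auto simp: sign_vectors_def)

lemma signs_of_in_sign_vectors [simp]: "signs_of p \<in> sign_vectors"
  by (simp add: signs_of_def sign_vectors_def)

lemma one_in_sign_vectors: "(\<chi> i. 1) \<in> sign_vectors"
  by (simp add: sign_vectors_def)

lemma sign_act_in_sign_vectors:
  assumes "\<sigma> \<in> sign_vectors" "\<tau> \<in> sign_vectors"
  shows "sign_act \<sigma> \<tau> \<in> sign_vectors"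
proof -
  have "\<sigma> $ i * \<tau> $ i = - 1 \<or> \<sigma> $ i * \<tau> $ i = 1" for i
    using sign_vectors_cases[OF assms(1), of i] sign_vectors_cases[OF assms(2), of i] by auto
  then show ?thesis
    by (simp add: sign_vectors_def sign_act_def)
qed

lemma sign_act_nth [simp]: "sign_act \<sigma> p $ i = \<sigma> $ i * p $ i"
  by (simp add: sign_act_def)

lemma abs_vec_nth [simp]: "abs_vec p $ i = \<bar>p $ i\<bar>"
  by (simp add: abs_vec_def)

lemma sign_act_one: "sign_act (\<chi> i. 1) p = p"
  by (simp add: vec_eq_iff)

lemma sign_act_assoc: "sign_act \<sigma> (sign_act \<tau> p) = sign_act (sign_act \<sigma> \<tau>) p"
  by (simp add: vec_eq_iff)

lemma sign_act_signs_of_self: "sign_act (signs_of p) p = abs_vec p"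
  by (simp add: vec_eq_iff signs_of_def)

lemma sign_act_signs_of_abs_vec: "sign_act (signs_of p) (abs_vec p) = p"
  by (simp add: vec_eq_iff signs_of_def)

lemma linear_sign_act: "linear (sign_act \<sigma>)"
  by (rule linearI) (simp_all add: vec_eq_iff algebra_simps)

lemma sign_act_involutive:
  assumes "\<sigma> \<in> sign_vectors"
  shows "sign_act \<sigma> (sign_act \<sigma> p) = p"
proof -
  have "\<sigma> $ i * (\<sigma> $ i * p $ i) = p $ i" for i
    using sign_vectors_cases[OF assms, of i] by auto
  then show ?thesis
    by (simp add: vec_eq_iff)
qed

lemma inj_sign_act: "\<sigma> \<in> sign_vectors \<Longrightarrow> inj (sign_act \<sigma>)"
  by (metis injI sign_act_involutive)

lemma sign_act_image_involutive:
  "\<sigma> \<in> sign_vectors \<Longrightarrow> sign_act \<sigma> ` sign_act \<sigma> ` S = S"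
  by (simp add: image_image sign_act_involutive)

lemma mem_sign_act_image_iff:
  "\<sigma> \<in> sign_vectors \<Longrightarrow> p \<in> sign_act \<sigma> ` S \<longleftrightarrow> sign_act \<sigma> p \<in> S"
  by (metis image_iff sign_act_involutive)

lemma abs_vec_sign_act:
  assumes "\<sigma> \<in> sign_vectors"
  shows "abs_vec (sign_act \<sigma> p) = abs_vec p"
proof -
  have "\<bar>\<sigma> $ i * p $ i\<bar> = \<bar>p $ i\<bar>" for i
    using sign_vectors_cases[OF assms, of i] by auto
  then show ?thesis
    by (simp add: vec_eq_iff)
qed

lemma abs_vec_of_nonneg: "(\<And>i. 0 \<le> p $ i) \<Longrightarrow> abs_vec p = p"
  by (simp add: vec_eq_iff)

text \<open>Both points are nonnegative and have the same absolute values, so they coincide. This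
  controls all overlaps between the nonnegative orthant and its reflections.\<close>

lemma sign_act_fixed:
  assumes "\<sigma> \<in> sign_vectors" "\<And>i. 0 \<le> p $ i" "\<And>i. 0 \<le> sign_act \<sigma> p $ i"
  shows "sign_act \<sigma> p = p"
  by (metis abs_vec_of_nonneg abs_vec_sign_act assms)

lemma inner_sign_act: "sign_act \<sigma> c \<bullet> v = c \<bullet> sign_act \<sigma> v"
  by (simp add: inner_vec_def algebra_simps)

lemma extreme_point_of_sign_act_image:
  assumes "\<sigma> \<in> sign_vectors"
  shows "v extreme_point_of sign_act \<sigma> ` S \<longleftrightarrow> sign_act \<sigma> v extreme_point_of S"
  using face_of_linear_image[OF linear_sign_act inj_sign_act[OF assms], of "{sign_act \<sigma> v}" S]
  by (simp add: sign_act_involutive[OF assms] face_of_singleton)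

text \<open>A finite set is affinely independent when its cardinality exceeds its affine dimension
  by one, and an injective linear map preserves both numbers.\<close>

lemma simplex_linear_image:
  fixes f :: "'a::euclidean_space \<Rightarrow> 'b::euclidean_space"
  assumes "linear f" "inj f" "n simplex S"
  shows "n simplex (f ` S)"
proof -
  obtain C where C: "\<not> affine_dependent C" "int (card C) = n + 1" "S = convex hull C"
    using assms(3) by (auto simp: simplex_def)
  have "card (f ` C) = card C"
    using assms(2) by (simp add: card_image inj_on_subset)
  moreover have "\<not> affine_dependent (f ` C)"
    using C(1) assms(1,2) calculation by (simp add: affine_independent_iff_card)
  ultimately show ?thesis
    unfolding simplex_def using C assms(1) by (metis convex_hull_linear_image)
qed

section \<open>The unconditional polytope and its triangulation\<close>

lemma unconditional_iff: "p \<in> unconditional P \<longleftrightarrow> abs_vec p \<in> P"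
  by (simp add: unconditional_def abs_vec_def)

lemma unconditional_familyI:
  "\<sigma> \<in> sign_vectors \<Longrightarrow> S \<in> \<T> \<Longrightarrow> sign_act \<sigma> ` S \<in> unconditional_family \<T>"
  by (auto simp: unconditional_family_def)

lemma unconditional_familyE:
  assumes "X \<in> unconditional_family \<T>"
  obtains \<sigma> S where "\<sigma> \<in> sign_vectors" "S \<in> \<T>" "X = sign_act \<sigma> ` S"
  using assms by (auto simp: unconditional_family_def)

lemma finite_sign_vectors: "finite (sign_vectors :: (real ^ 'n) set)"
proof -
  have "finite {f :: 'n \<Rightarrow> real. range f \<subseteq> {- 1, 1}}"
    using finite_set_of_finite_funs[of "UNIV :: 'n set" "{- 1, 1 :: real}"]
    by (simp add: image_subset_iff)
  moreover have "sign_vectors \<subseteq> vec_lambda ` {f :: 'n \<Rightarrow> real. range f \<subseteq> {- 1, 1}}"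
  proof
    fix s :: "real ^ 'n" assume "s \<in> sign_vectors"
    then have "range (vec_nth s) \<subseteq> {- 1, 1}"
      by (auto simp: sign_vectors_def)
    then show "s \<in> vec_lambda ` {f :: 'n \<Rightarrow> real. range f \<subseteq> {- 1, 1}}"
      by (intro image_eqI[of _ _ "vec_nth s"]) auto
  qed
  ultimately show ?thesis
    using finite_surj by blast
qed

lemma finite_unconditional_family:
  assumes "finite \<T>"
  shows "finite (unconditional_family \<T>)"
proof -
  have "unconditional_family \<T> = (\<lambda>(\<sigma>, S). sign_act \<sigma> ` S) ` (sign_vectors \<times> \<T>)"
    by (auto simp: unconditional_family_def)
  then show ?thesis
    using assms finite_sign_vectors by (metis finite_SigmaI finite_imageI)
qed

lemma vertices_of_unconditional_family:
  "v \<in> vertices_of (unconditional_family \<T>) \<longleftrightarrow>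
     (\<exists>\<sigma>\<in>sign_vectors. sign_act \<sigma> v \<in> vertices_of \<T>)"
proof
  assume "v \<in> vertices_of (unconditional_family \<T>)"
  then obtain X where "X \<in> unconditional_family \<T>" "v extreme_point_of X"
    by (auto simp: vertices_of_def)
  then obtain \<sigma> S where "\<sigma> \<in> sign_vectors" "S \<in> \<T>" "v extreme_point_of sign_act \<sigma> ` S"
    by (metis unconditional_familyE)
  then show "\<exists>\<sigma>\<in>sign_vectors. sign_act \<sigma> v \<in> vertices_of \<T>"
    unfolding vertices_of_def by (auto simp: extreme_point_of_sign_act_image)
next
  assume "\<exists>\<sigma>\<in>sign_vectors. sign_act \<sigma> v \<in> vertices_of \<T>"
  then obtain \<sigma> S where \<sigma>: "\<sigma> \<in> sign_vectors" "S \<in> \<T>" "sign_act \<sigma> v extreme_point_of S"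
    by (auto simp: vertices_of_def)
  then have "v extreme_point_of sign_act \<sigma> ` S"
    by (simp add: extreme_point_of_sign_act_image)
  then show "v \<in> vertices_of (unconditional_family \<T>)"
    unfolding vertices_of_def using unconditional_familyI[OF \<sigma>(1,2)] by blast
qed

lemma sign_act_vertices_of_unconditional_family:
  assumes "\<sigma> \<in> sign_vectors"
  shows "sign_act \<sigma> v \<in> vertices_of (unconditional_family \<T>) \<longleftrightarrow>
    v \<in> vertices_of (unconditional_family \<T>)"
  unfolding vertices_of_unconditional_family
  by (metis assms sign_act_assoc sign_act_in_sign_vectors sign_act_involutive)

text \<open>Nonnegativity makes \<open>abs_vec\<close> undo every reflection of a simplex;
  conversely, \<open>p\<close> is the reflection of \<open>abs_vec p\<close> by its own
  signs.\<close>

lemma Union_unconditional_family: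
  assumes "\<And>p i. p \<in> \<Union>\<T> \<Longrightarrow> 0 \<le> p $ i"
  shows "\<Union>(unconditional_family \<T>) = unconditional (\<Union>\<T>)"
proof (intro set_eqI iffI)
  fix p assume "p \<in> \<Union>(unconditional_family \<T>)"
  then obtain \<sigma> S q where "\<sigma> \<in> sign_vectors" "S \<in> \<T>" "q \<in> S" "p = sign_act \<sigma> q"
    by (auto elim: unconditional_familyE)
  moreover have "abs_vec q = q"
    using assms \<open>S \<in> \<T>\<close> \<open>q \<in> S\<close> by (intro abs_vec_of_nonneg) auto
  ultimately show "p \<in> unconditional (\<Union>\<T>)"
    by (auto simp: unconditional_iff abs_vec_sign_act)
next
  fix p assume "p \<in> unconditional (\<Union>\<T>)"
  then obtain S where "S \<in> \<T>" "abs_vec p \<in> S"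
    by (auto simp: unconditional_iff)
  then show "p \<in> \<Union>(unconditional_family \<T>)"
    by (metis UnionI image_eqI sign_act_signs_of_abs_vec signs_of_in_sign_vectors unconditional_familyI)
qed

section \<open>Convexity, generators and dimension of the unconditional polytope\<close>

text \<open>By the triangle inequality, the absolute values of a convex combination lie
  coordinatewise below the convex combination of the absolute values; downward closure of
  \<open>P\<close> does the rest.\<close>

lemma convex_unconditional:
  fixes P :: "(real ^ 'n) set"
  assumes "anti_blocking P"
  shows "convex (unconditional P)"
proof (rule convexI)
  fix x y :: "real ^ 'n" and u v :: real
  assume xy: "x \<in> unconditional P" "y \<in> unconditional P" and uv: "0 \<le> u" "0 \<le> v" "u + v = 1"
  have "convex P"
    using assms by (simp add: anti_blocking_def polytope_imp_convex)
  then have "u *\<^sub>R abs_vec x + v *\<^sub>R abs_vec y \<in> P"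
    using xy uv by (auto simp: unconditional_iff convex_def)
  moreover have "\<bar>u * x $ i + v * y $ i\<bar> \<le> u * \<bar>x $ i\<bar> + v * \<bar>y $ i\<bar>" for i
    by (metis abs_mult abs_of_nonneg abs_triangle_ineq uv(1) uv(2))
  ultimately have "abs_vec (u *\<^sub>R x + v *\<^sub>R y) \<in> P"
    using assms unfolding anti_blocking_def by fastforce
  then show "u *\<^sub>R x + v *\<^sub>R y \<in> unconditional P"
    by (simp add: unconditional_iff)
qed

text \<open>All reflections of a finite generating set of \<open>P\<close> generate: each point lies
  in the reflection of \<open>P\<close> by its own signs, and convexity gives the other
  inclusion.\<close>

lemma polytope_unconditional:
  assumes "anti_blocking P"
  shows "polytope (unconditional P)"
proof -
  obtain V where V: "finite V" "P = convex hull V"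
    using assms by (auto simp: anti_blocking_def polytope_def)
  define W where "W = (\<Union>\<sigma>\<in>sign_vectors. sign_act \<sigma> ` V)"
  have "W \<subseteq> unconditional P"
  proof
    fix w assume "w \<in> W"
    then obtain \<sigma> v where \<sigma>: "\<sigma> \<in> sign_vectors" "v \<in> V" "w = sign_act \<sigma> v"
      by (auto simp: W_def)
    then have "v \<in> P"
      using V by (simp add: hull_inc)
    moreover have "abs_vec v = v"
      using assms \<open>v \<in> P\<close> by (intro abs_vec_of_nonneg) (auto simp: anti_blocking_def)
    ultimately show "w \<in> unconditional P"
      using \<sigma> by (simp add: unconditional_iff abs_vec_sign_act)
  qed
  then have "convex hull W \<subseteq> unconditional P"
    by (simp add: hull_minimal convex_unconditional[OF assms])
  moreover have "unconditional P \<subseteq> convex hull W"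
  proof
    fix p assume "p \<in> unconditional P"
    then have "p \<in> sign_act (signs_of p) ` (convex hull V)"
      by (metis V(2) image_eqI sign_act_signs_of_abs_vec unconditional_iff)
    also have "\<dots> = convex hull (sign_act (signs_of p) ` V)"
      by (rule convex_hull_linear_image[OF linear_sign_act])
    also have "\<dots> \<subseteq> convex hull W"
      by (rule hull_mono) (use signs_of_in_sign_vectors in \<open>unfold W_def, blast\<close>)
    finally show "p \<in> convex hull W" .
  qed
  moreover have "finite W"
    using V by (simp add: W_def finite_sign_vectors)
  ultimately show ?thesis
    by (auto simp: polytope_def)
qed

text \<open>A nonempty \<open>P\<close> contains 0, so its affine hull is its span, and this span
  contains the axis components of every point of \<open>unconditional P\<close>.\<close>

lemma aff_dim_unconditional:
  assumes "anti_blocking P"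
  shows "aff_dim (unconditional P) = aff_dim P"
proof (cases "P = {}")
  case True
  then show ?thesis
    by (simp add: unconditional_def)
next
  case False
  have down: "p \<in> P" if "q \<in> P" "\<And>i. 0 \<le> p $ i \<and> p $ i \<le> q $ i" for p q
    using assms that unfolding anti_blocking_def by blast
  have nonneg: "0 \<le> q $ i" if "q \<in> P" for q i
    using assms that by (simp add: anti_blocking_def)
  obtain q where "q \<in> P"
    using False by blast
  then have "0 \<in> P"
    by (rule down) (simp add: nonneg \<open>q \<in> P\<close>)
  then have aff: "affine hull P = span P"
    by (simp add: affine_hull_span_0 hull_inc)
  have "unconditional P \<subseteq> span P"
  proof
    fix p assume "p \<in> unconditional P"
    then have "abs_vec p \<in> P"
      by (simp add: unconditional_iff)
    \<comment> \<open>Downward closure: \<open>abs_vec p\<close> stays in \<open>P\<close> when all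
      but one coordinate are set to 0.\<close>
    then have "axis i \<bar>p $ i\<bar> \<in> P" for i
      by (rule down) (simp add: axis_def)
    then have "sgn (p $ i) *\<^sub>R axis i \<bar>p $ i\<bar> \<in> span P" for i
      by (intro span_mul span_base)
    moreover have "sgn (p $ i) *\<^sub>R axis i \<bar>p $ i\<bar> = axis i (p $ i)" for i
      by (simp add: vec_eq_iff axis_def sgn_mult_abs)
    ultimately have "(\<Sum>i\<in>UNIV. axis i (p $ i)) \<in> span P"
      by (intro span_sum) metis
    moreover have "(\<Sum>i\<in>UNIV. axis i (p $ i)) = p"
      by (simp add: vec_eq_iff axis_def)
    ultimately show "p \<in> span P"
      by simp
  qed
  then have "aff_dim (unconditional P) \<le> aff_dim P"
    by (metis aff aff_dim_affine_hull aff_dim_subset)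
  moreover have "P \<subseteq> unconditional P"
    using nonneg by (metis abs_vec_of_nonneg subsetI unconditional_iff)
  ultimately show ?thesis
    by (meson aff_dim_subset order_antisym)
qed

text \<open>Since the simplices lie in the positive orthant, a point of \<open>S \<inter> \<tau>S'\<close> vanishes in the
  coordinates flipped by \<open>\<tau>\<close>, so it is fixed by \<open>\<tau>\<close>.\<close>

lemma Int_sign_act_image_face_of:
  fixes S S' :: "(real ^ 'n) set"
  assumes \<tau>: "\<tau> \<in> sign_vectors"
    and S: "\<And>p i. p \<in> S \<Longrightarrow> 0 \<le> p $ i" and S': "\<And>p i. p \<in> S' \<Longrightarrow> 0 \<le> p $ i"
    and "convex S" and face: "S \<inter> S' face_of S"
  shows "S \<inter> sign_act \<tau> ` S' face_of S"
proof -
  \<comment> \<open>\<open>a\<close> marks the coordinates flipped by \<tau>. The hyperplane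
    \<open>a \<bullet> p = 0\<close> supports \<open>S\<close>, and it contains exactly those points
    of \<open>S\<close> that \<tau> fixes.\<close>
  define a :: "real ^ 'n" where "a = (\<chi> i. if \<tau> $ i = - 1 then 1 else 0)"
  have inner_a: "a \<bullet> p = 0 \<longleftrightarrow> sign_act \<tau> p = p" if "p \<in> S" for p
  proof -
    have "a \<bullet> p = 0 \<longleftrightarrow> (\<forall>i. a $ i * p $ i = 0)"
      using S[OF that] by (simp add: inner_vec_def a_def sum_nonneg_eq_0_iff)
    also have "\<dots> \<longleftrightarrow> (\<forall>i. \<tau> $ i * p $ i = p $ i)"
    proof (rule iff_allI)
      fix i show "a $ i * p $ i = 0 \<longleftrightarrow> \<tau> $ i * p $ i = p $ i"
        using sign_vectors_cases[OF \<tau>, of i] by (auto simp: a_def)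
    qed
    finally show ?thesis
      by (simp add: vec_eq_iff)
  qed
  have "a \<bullet> p \<ge> 0" if "p \<in> S" for p
    unfolding inner_vec_def using S[OF that] by (intro sum_nonneg) (simp add: a_def)
  then have "S \<inter> {p. a \<bullet> p = 0} face_of S"
    using \<open>convex S\<close> by (intro face_of_Int_supporting_hyperplane_ge) auto
  with face have "(S \<inter> S') \<inter> (S \<inter> {p. a \<bullet> p = 0}) face_of S"
    by (rule face_of_Int)
  moreover have "(S \<inter> S') \<inter> (S \<inter> {p. a \<bullet> p = 0}) = S \<inter> sign_act \<tau> ` S'"
  proof (intro set_eqI iffI)
    fix p assume "p \<in> (S \<inter> S') \<inter> (S \<inter> {p. a \<bullet> p = 0})"
    then show "p \<in> S \<inter> sign_act \<tau> ` S'"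
      using inner_a by (auto simp: mem_sign_act_image_iff[OF \<tau>])
  next
    fix p assume "p \<in> S \<inter> sign_act \<tau> ` S'"
    then have p: "p \<in> S" "sign_act \<tau> p \<in> S'"
      by (auto simp: mem_sign_act_image_iff[OF \<tau>])
    then have "sign_act \<tau> p = p"
      using S S' by (intro sign_act_fixed[OF \<tau>]) blast+
    then show "p \<in> (S \<inter> S') \<inter> (S \<inter> {p. a \<bullet> p = 0})"
      using p inner_a by auto
  qed
  ultimately show ?thesis
    by simp
qed

text \<open>Applying \<sigma> turns the intersection of \<sigma>S and \<tau>S' into that of
  \<open>S\<close> with a single reflection of \<open>S'\<close>, by the product of the two sign
  vectors.\<close>

lemma triangulation_unconditional_family:
  assumes T: "triangulation \<T>" and pos: "\<And>p i. p \<in> \<Union>\<T> \<Longrightarrow> 0 \<le> p $ i"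
  shows "triangulation (unconditional_family \<T>)"
  unfolding triangulation_def
proof (intro conjI ballI allI impI)
  show "finite (unconditional_family \<T>)"
    using T by (simp add: triangulation_def finite_unconditional_family)
next
  fix X assume "X \<in> unconditional_family \<T>"
  then show "\<exists>n. n simplex X"
    by (metis T inj_sign_act linear_sign_act simplex_linear_image triangulation_def
        unconditional_familyE)
next
  fix X X' assume "X \<in> unconditional_family \<T> \<and> X' \<in> unconditional_family \<T>"
  then obtain \<sigma> S \<tau> S' where
    X: "\<sigma> \<in> sign_vectors" "S \<in> \<T>" "X = sign_act \<sigma> ` S" and
    X': "\<tau> \<in> sign_vectors" "S' \<in> \<T>" "X' = sign_act \<tau> ` S'"
    by (metis unconditional_familyE)
  have "S \<inter> sign_act (sign_act \<sigma> \<tau>) ` S' face_of S"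
  proof (rule Int_sign_act_image_face_of)
    show "sign_act \<sigma> \<tau> \<in> sign_vectors"
      using X X' by (simp add: sign_act_in_sign_vectors)
    show "convex S"
      using T X by (metis convex_simplex triangulation_def)
    show "S \<inter> S' face_of S"
      using T X X' by (simp add: triangulation_def)
  qed (use pos X X' in auto)
  then have "sign_act \<sigma> ` (S \<inter> sign_act (sign_act \<sigma> \<tau>) ` S') face_of sign_act \<sigma> ` S"
    by (simp add: face_of_linear_image linear_sign_act inj_sign_act X)
  moreover have "sign_act \<sigma> ` (S \<inter> sign_act (sign_act \<sigma> \<tau>) ` S') = X \<inter> X'"
    by (simp add: X X' image_Int inj_sign_act image_image sign_act_involutive
        flip: sign_act_assoc)
  ultimately show "X \<inter> X' face_of X"
    using X by simp
qed

lemma triangulation_of_unconditional: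
  assumes "anti_blocking P" "triangulation_of \<T> P"
  shows "triangulation_of (unconditional_family \<T>) (unconditional P)"
proof -
  have T: "triangulation \<T>" "\<And>S. S \<in> \<T> \<Longrightarrow> aff_dim P simplex S" "\<Union>\<T> = P"
    using assms(2) by (auto simp: triangulation_of_def)
  have pos: "\<And>p i. p \<in> \<Union>\<T> \<Longrightarrow> 0 \<le> p $ i"
    using assms(1) T(3) by (simp add: anti_blocking_def)
  have "aff_dim P simplex X" if "X \<in> unconditional_family \<T>" for X
    using that T(2) by (metis inj_sign_act linear_sign_act simplex_linear_image
        unconditional_familyE)
  then show ?thesis
    unfolding triangulation_of_def
    using Union_unconditional_family[of \<T>, OF pos] triangulation_unconditional_family[OF T(1) pos]
    by (simp add: T(3) polytope_unconditional aff_dim_unconditional assms(1))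
qed

section \<open>Unimodularity\<close>

lemma integer_vectors_sign_act:
  assumes "\<sigma> \<in> sign_vectors"
  shows "(\<forall>i. sign_act \<sigma> x $ i \<in> \<int>) \<longleftrightarrow> (\<forall>i. x $ i \<in> \<int>)"
proof (rule iff_allI)
  fix i show "sign_act \<sigma> x $ i \<in> \<int> \<longleftrightarrow> x $ i \<in> \<int>"
    using sign_vectors_cases[OF assms, of i] by auto
qed

text \<open>An integer combination over the reflected set with coefficients \<open>c\<close> is the
  reflection of the one over \<open>B\<close> whose coefficients are \<open>c\<close> composed with
  \<sigma>. So the generated group is reflected, and the integer lattice is its own
  reflection.\<close>

lemma lattice_basis_sign_act:
  fixes B :: "(real ^ 'n) set"
  assumes \<sigma>: "\<sigma> \<in> sign_vectors" and B: "lattice_basis B"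
  shows "lattice_basis (sign_act \<sigma> ` B)"
proof -
  have sum_image: "(\<Sum>b\<in>sign_act \<sigma> ` B. of_int (c b) *\<^sub>R b) =
      sign_act \<sigma> (\<Sum>b\<in>B. of_int (c (sign_act \<sigma> b)) *\<^sub>R b)" for c :: "real ^ 'n \<Rightarrow> int"
    using inj_sign_act[OF \<sigma>]
    by (simp add: sum.reindex inj_on_subset linear_sum[OF linear_sign_act]
        linear_scale[OF linear_sign_act])
  let ?L = "\<lambda>B. {\<Sum>b\<in>B. of_int (c b) *\<^sub>R b | c :: real ^ 'n \<Rightarrow> int. True}"
  have "?L (sign_act \<sigma> ` B) = sign_act \<sigma> ` ?L B"
  proof (intro subset_antisym subsetI)
    fix x assume "x \<in> ?L (sign_act \<sigma> ` B)"
    then obtain c :: "real ^ 'n \<Rightarrow> int" where "x = (\<Sum>b\<in>sign_act \<sigma> ` B. of_int (c b) *\<^sub>R b)"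
      by blast
    then have "x = sign_act \<sigma> (\<Sum>b\<in>B. of_int ((c \<circ> sign_act \<sigma>) b) *\<^sub>R b)"
      by (simp add: sum_image)
    then show "x \<in> sign_act \<sigma> ` ?L B"
      by blast
  next
    fix x assume "x \<in> sign_act \<sigma> ` ?L B"
    then obtain c :: "real ^ 'n \<Rightarrow> int" where "x = sign_act \<sigma> (\<Sum>b\<in>B. of_int (c b) *\<^sub>R b)"
      by blast
    then have "x = (\<Sum>b\<in>sign_act \<sigma> ` B. of_int ((c \<circ> sign_act \<sigma>) b) *\<^sub>R b)"
      by (simp add: sum_image sign_act_involutive[OF \<sigma>])
    then show "x \<in> ?L (sign_act \<sigma> ` B)"
      by blast
  qed
  also have "\<dots> = sign_act \<sigma> ` {x. \<forall>i. x $ i \<in> \<int>}"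
    using B by (simp add: lattice_basis_def)
  also have "\<dots> = {x. \<forall>i. x $ i \<in> \<int>}"
    using integer_vectors_sign_act[OF \<sigma>]
    by (intro set_eqI) (simp only: mem_sign_act_image_iff[OF \<sigma>] mem_Collect_eq)
  finally have "?L (sign_act \<sigma> ` B) = {x. \<forall>i. x $ i \<in> \<int>}" .
  moreover have "independent (sign_act \<sigma> ` B)"
    using B inj_sign_act[OF \<sigma>]
    by (intro linear_independent_injective_image[OF linear_sign_act])
      (auto simp: lattice_basis_def intro: inj_on_subset)
  ultimately show ?thesis
    by (simp add: lattice_basis_def)
qed

text \<open>The base vertex is reflected along with the simplex; by linearity the edge vectors at it
  become the reflected edge vectors.\<close>

lemma unimodular_simplex_sign_act:
  assumes \<sigma>: "\<sigma> \<in> sign_vectors" and S: "unimodular_simplex S"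
  shows "unimodular_simplex (sign_act \<sigma> ` S)"
proof -
  obtain w where w: "w extreme_point_of S"
    "lattice_basis {v - w | v. v extreme_point_of S \<and> v \<noteq> w}"
    using S by (auto simp: unimodular_simplex_def)
  have "{v - sign_act \<sigma> w | v. v extreme_point_of sign_act \<sigma> ` S \<and> v \<noteq> sign_act \<sigma> w} =
      sign_act \<sigma> ` {v - w | v. v extreme_point_of S \<and> v \<noteq> w}" (is "?A = ?B")
  proof (intro subset_antisym subsetI)
    fix x assume "x \<in> ?A"
    then obtain v where "x = v - sign_act \<sigma> w" "sign_act \<sigma> v extreme_point_of S"
      "v \<noteq> sign_act \<sigma> w"
      by (auto simp: extreme_point_of_sign_act_image[OF \<sigma>])
    moreover have "v - sign_act \<sigma> w = sign_act \<sigma> (sign_act \<sigma> v - w)"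
      by (simp add: linear_diff[OF linear_sign_act] sign_act_involutive[OF \<sigma>])
    moreover have "sign_act \<sigma> v \<noteq> w"
      using calculation(3) sign_act_involutive[OF \<sigma>] by metis
    ultimately show "x \<in> ?B"
      by blast
  next
    fix x assume "x \<in> ?B"
    then obtain v where v: "x = sign_act \<sigma> (v - w)" "v extreme_point_of S" "v \<noteq> w"
      by blast
    then have "sign_act \<sigma> v extreme_point_of sign_act \<sigma> ` S" "sign_act \<sigma> v \<noteq> sign_act \<sigma> w"
      by (simp_all add: extreme_point_of_sign_act_image[OF \<sigma>] sign_act_involutive[OF \<sigma>]
          inj_eq[OF inj_sign_act[OF \<sigma>]])
    then show "x \<in> ?A"
      using v(1) linear_diff[OF linear_sign_act] by blast
  qed
  then show ?thesis
    unfolding unimodular_simplex_def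
    using w lattice_basis_sign_act[OF \<sigma> w(2)]
    by (intro exI[of _ "sign_act \<sigma> w"])
      (simp add: extreme_point_of_sign_act_image[OF \<sigma>] sign_act_involutive[OF \<sigma>])
qed

lemma unimodular_unconditional_family:
  "unimodular_triangulation \<T> \<Longrightarrow> unimodular_triangulation (unconditional_family \<T>)"
  unfolding unimodular_triangulation_def
  by (metis unconditional_familyE unimodular_simplex_sign_act)

section \<open>Regularity\<close>

text \<open>Meant for affine functions below \<omega> on \<open>V\<close>: the hull of the contact
  points is then the projection of the lower face in which the graph of the function meets the
  lifted polytope.\<close>

definition contact_set :: "(real ^ 'n) set \<Rightarrow> (real ^ 'n \<Rightarrow> real) \<Rightarrow> real ^ 'n \<Rightarrow> real \<Rightarrow> (real ^ 'n) set"
  where "contact_set V \<omega> c b = {v \<in> V. c \<bullet> v + b = \<omega> v}"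

text \<open>A face of the hull of a finite set is the hull of some of its points, and these points
  lie on the hyperplane.\<close>

lemma convex_hull_Int_supporting_hyperplane:
  fixes X :: "'a::euclidean_space set"
  assumes "finite X" "\<And>x. x \<in> X \<Longrightarrow> a \<bullet> x \<le> b"
  shows "(convex hull X) \<inter> {x. a \<bullet> x = b} = convex hull (X \<inter> {x. a \<bullet> x = b})"
proof
  have "convex hull X \<subseteq> {x. a \<bullet> x \<le> b}"
    using assms(2) by (intro hull_minimal) (auto simp: convex_halfspace_le)
  then have "(convex hull X) \<inter> {x. a \<bullet> x = b} face_of convex hull X"
    by (intro face_of_Int_supporting_hyperplane_le) auto
  then obtain Y where "Y \<subseteq> X" "(convex hull X) \<inter> {x. a \<bullet> x = b} = convex hull Y"
    using assms(1) finite_imp_compact face_of_convex_hull_subset by metis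
  moreover from this have "Y \<subseteq> {x. a \<bullet> x = b}"
    by (metis hull_subset le_inf_iff)
  ultimately show "(convex hull X) \<inter> {x. a \<bullet> x = b} \<subseteq> convex hull (X \<inter> {x. a \<bullet> x = b})"
    by (simp add: hull_mono)
  show "convex hull (X \<inter> {x. a \<bullet> x = b}) \<subseteq> (convex hull X) \<inter> {x. a \<bullet> x = b}"
    by (intro hull_minimal convex_Int convex_convex_hull convex_hyperplane) (auto simp: hull_inc)
qed

text \<open>Scaling the outer normal to last coordinate -1 makes the hyperplane the graph of an
  affine function. Supporting the lifted polytope then means lying below all heights.\<close>

lemma lower_face_of_lifted_polytope_iff:
  assumes "finite V"
  shows "lower_face_of F (lifted_polytope V \<omega>) \<longleftrightarrow>
    (\<exists>c b. (\<forall>v\<in>V. c \<bullet> v + b \<le> \<omega> v) \<and>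
       F = convex hull ((\<lambda>v. (v, \<omega> v)) ` contact_set V \<omega> c b))"
proof
  assume "lower_face_of F (lifted_polytope V \<omega>)"
  then obtain a d where a: "snd a < 0" "lifted_polytope V \<omega> \<subseteq> {y. a \<bullet> y \<le> d}"
    "F = lifted_polytope V \<omega> \<inter> {y. a \<bullet> y = d}"
    unfolding lower_face_of_def by blast
  \<comment> \<open>The scaling factor; it is positive because the face is lower.\<close>
  define h where "h = - snd a"
  define c where "c = fst a /\<^sub>R h"
  define b where "b = - d / h"
  have "h > 0"
    using a by (simp add: h_def)
  have in_a: "a \<bullet> (v, t) = d + h * (c \<bullet> v + b - t)" for v t
    using \<open>h > 0\<close> by (cases a) (simp add: c_def b_def h_def field_simps)
  have "a \<bullet> (v, \<omega> v) \<le> d" if "v \<in> V" for v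
    using a(2) that unfolding lifted_polytope_def
    by (meson hull_inc imageI mem_Collect_eq subsetD)
  then have le: "c \<bullet> v + b \<le> \<omega> v" if "v \<in> V" for v
    using that \<open>h > 0\<close> by (auto simp: in_a mult_le_0_iff)
  have "F = convex hull ((\<lambda>v. (v, \<omega> v)) ` V \<inter> {y. a \<bullet> y = d})"
    unfolding a(3) lifted_polytope_def
    using assms le \<open>h > 0\<close>
    by (intro convex_hull_Int_supporting_hyperplane) (auto simp: in_a mult_le_0_iff)
  also have "(\<lambda>v. (v, \<omega> v)) ` V \<inter> {y. a \<bullet> y = d} = (\<lambda>v. (v, \<omega> v)) ` contact_set V \<omega> c b"
    using \<open>h > 0\<close> by (auto simp: in_a contact_set_def)
  finally show "\<exists>c b. (\<forall>v\<in>V. c \<bullet> v + b \<le> \<omega> v) \<and>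
       F = convex hull ((\<lambda>v. (v, \<omega> v)) ` contact_set V \<omega> c b)"
    using le by blast
next
  assume "\<exists>c b. (\<forall>v\<in>V. c \<bullet> v + b \<le> \<omega> v) \<and>
       F = convex hull ((\<lambda>v. (v, \<omega> v)) ` contact_set V \<omega> c b)"
  then obtain c b where le: "\<And>v. v \<in> V \<Longrightarrow> c \<bullet> v + b \<le> \<omega> v"
    and F: "F = convex hull ((\<lambda>v. (v, \<omega> v)) ` contact_set V \<omega> c b)"
    by blast
  let ?X = "(\<lambda>v. (v, \<omega> v)) ` V"
  have X: "(c, - 1) \<bullet> x \<le> - b" if "x \<in> ?X" for x
    using that le by fastforce
  have "?X \<inter> {y. (c, - 1) \<bullet> y = - b} = (\<lambda>v. (v, \<omega> v)) ` contact_set V \<omega> c b"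
    by (auto simp: contact_set_def algebra_simps)
  then have "F = lifted_polytope V \<omega> \<inter> {y. (c, - 1) \<bullet> y = - b}"
    unfolding F lifted_polytope_def
    using convex_hull_Int_supporting_hyperplane[OF _ X] assms by simp
  moreover have "lifted_polytope V \<omega> \<subseteq> {y. (c, - 1) \<bullet> y \<le> - b}"
    unfolding lifted_polytope_def
    by (intro hull_minimal convex_halfspace_le) (use X in auto)
  ultimately show "lower_face_of F (lifted_polytope V \<omega>)"
    unfolding lower_face_of_def by (intro exI[of _ "(c, - 1)"] exI[of _ "- b"]) simp
qed

lemma fst_convex_hull_graph:
  "fst ` (convex hull ((\<lambda>v. (v, \<omega> v)) ` A)) = convex hull A"
  by (simp add: convex_hull_linear_image[OF linear_fst] image_image)

text \<open>On contact points \<omega> agrees with the affine function, so lifting them is a linear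
  injection followed by a translation.\<close>

lemma aff_dim_convex_hull_contact_set:
  fixes V :: "(real ^ 'n) set"
  shows "aff_dim (convex hull ((\<lambda>v. (v, \<omega> v)) ` contact_set V \<omega> c b)) = aff_dim (contact_set V \<omega> c b)"
proof -
  let ?g = "\<lambda>v :: real ^ 'n. (v, c \<bullet> v)"
  have "linear ?g"
    by (rule linearI) (auto simp: inner_add_right)
  moreover have "inj ?g"
    by (rule injI) simp
  moreover have "(\<lambda>v. (v, \<omega> v)) ` contact_set V \<omega> c b = (+) (0, b) ` ?g ` contact_set V \<omega> c b"
    by (force simp: contact_set_def image_iff)
  ultimately show ?thesis
    by (simp only: aff_dim_convex_hull aff_dim_translation_eq aff_dim_injective_linear_image)
qed

text \<open>Replaces lower faces of the lifted polytope by affine functions on the finite vertex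
  set; projecting a lower face loses no dimension.\<close>

lemma regular_triangulation_iff_contact_sets:
  assumes "finite (vertices_of \<T>)"
  shows "regular_triangulation \<T> \<longleftrightarrow>
    (\<exists>\<omega>. \<T> = {convex hull contact_set (vertices_of \<T>) \<omega> c b | c b.
        (\<forall>v\<in>vertices_of \<T>. c \<bullet> v + b \<le> \<omega> v) \<and>
        aff_dim (contact_set (vertices_of \<T>) \<omega> c b) = aff_dim (\<Union>\<T>)})"
proof -
  let ?V = "vertices_of \<T>" and ?d = "aff_dim (\<Union>\<T>)"
  have "{fst ` F | F. lower_face_of F (lifted_polytope ?V \<omega>) \<and> aff_dim F = ?d} =
      {convex hull contact_set ?V \<omega> c b | c b.
        (\<forall>v\<in>?V. c \<bullet> v + b \<le> \<omega> v) \<and> aff_dim (contact_set ?V \<omega> c b) = ?d}"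
    (is "?L = ?R") for \<omega>
  proof -
    let ?G = "\<lambda>c b. convex hull ((\<lambda>v. (v, \<omega> v)) ` contact_set ?V \<omega> c b)"
    have "?L = {fst ` ?G c b | c b. (\<forall>v\<in>?V. c \<bullet> v + b \<le> \<omega> v) \<and> aff_dim (?G c b) = ?d}"
      unfolding lower_face_of_lifted_polytope_iff[OF assms] by blast
    then show ?thesis
      unfolding fst_convex_hull_graph aff_dim_convex_hull_contact_set .
  qed
  then show ?thesis
    unfolding regular_triangulation_def by simp
qed

text \<open>The difference of the two affine functions is nonnegative on the second hull and
  nonpositive on the first one.\<close>

lemma contact_set_subset:
  assumes 1: "\<And>v. v \<in> V \<Longrightarrow> c \<bullet> v + b \<le> \<omega> v" and 2: "\<And>v. v \<in> V \<Longrightarrow> c' \<bullet> v + b' \<le> \<omega> v"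
    and p: "p \<in> convex hull contact_set V \<omega> c b"
    and p': "p \<in> rel_interior (convex hull contact_set V \<omega> c' b')"
  shows "contact_set V \<omega> c' b' \<subseteq> contact_set V \<omega> c b"
proof -
  let ?A = "contact_set V \<omega> c b" and ?B = "contact_set V \<omega> c' b'"
  have "?A \<subseteq> {x. (c' - c) \<bullet> x \<le> b - b'}"
    using 2 by (fastforce simp: contact_set_def inner_diff_left)
  then have A: "convex hull ?A \<subseteq> {x. (c' - c) \<bullet> x \<le> b - b'}"
    by (intro hull_minimal convex_halfspace_le)
  have "?B \<subseteq> {x. (c' - c) \<bullet> x \<ge> b - b'}"
    using 1 by (fastforce simp: contact_set_def inner_diff_left)
  then have B: "convex hull ?B \<subseteq> {x. (c' - c) \<bullet> x \<ge> b - b'}"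
    by (intro hull_minimal convex_halfspace_ge)
  let ?F = "(convex hull ?B) \<inter> {x. (c' - c) \<bullet> x = b - b'}"
  have "?F face_of convex hull ?B"
    using B by (intro face_of_Int_supporting_hyperplane_ge) auto
  moreover have "p \<in> ?F"
    using A B p p' rel_interior_subset by fastforce
  \<comment> \<open>A face that meets the relative interior of a convex set is the whole
    set.\<close>
  ultimately have "convex hull ?B \<subseteq> ?F"
    using p' by (intro subset_of_face_of[of ?F "convex hull ?B"]) auto
  then have "?B \<subseteq> {x. (c' - c) \<bullet> x = b - b'}"
    by (meson hull_subset le_inf_iff subset_trans)
  then show ?thesis
    by (fastforce simp: contact_set_def inner_diff_left)
qed

section \<open>Vertices of simplices and criteria for regularity\<close>

lemma simplex_extreme_points:
  assumes "n simplex S"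
  shows "\<not> affine_dependent {v. v extreme_point_of S}" "S = convex hull {v. v extreme_point_of S}"
    "aff_dim {v. v extreme_point_of S} = n"
proof -
  obtain C where C: "\<not> affine_dependent C" "int (card C) = n + 1" "S = convex hull C"
    using assms by (auto simp: simplex_def)
  then have "{v. v extreme_point_of S} = C"
    by (simp add: extreme_point_of_convex_hull_affine_independent)
  then show "\<not> affine_dependent {v. v extreme_point_of S}"
    "S = convex hull {v. v extreme_point_of S}" "aff_dim {v. v extreme_point_of S} = n"
    using C by (simp_all add: aff_dim_affine_independent)
qed

text \<open>A vertex of another simplex \<open>S'\<close> that lies in \<open>S\<close> lies in
  their common face; extremality passes down from \<open>S'\<close> to that face and up to
  \<open>S\<close>.\<close>

lemma vertices_of_Int_simplex:
  assumes "triangulation \<T>" "S \<in> \<T>"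
  shows "vertices_of \<T> \<inter> S = {v. v extreme_point_of S}"
proof (intro set_eqI iffI)
  fix v assume "v \<in> vertices_of \<T> \<inter> S"
  then obtain S' where S': "S' \<in> \<T>" "v extreme_point_of S'" "v \<in> S"
    by (auto simp: vertices_of_def)
  have "S \<inter> S' face_of S'" "S \<inter> S' face_of S"
    using assms S'(1) by (metis triangulation_def inf_commute)+
  then show "v \<in> {v. v extreme_point_of S}"
    using S' by (metis IntI extreme_point_of_def extreme_point_of_face mem_Collect_eq)
next
  fix v assume "v \<in> {v. v extreme_point_of S}"
  then show "v \<in> vertices_of \<T> \<inter> S"
    using assms(2) by (auto simp: vertices_of_def extreme_point_of_def)
qed

lemma finite_vertices_of:
  assumes "triangulation \<T>"
  shows "finite (vertices_of \<T>)"
proof -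
  have "vertices_of \<T> = (\<Union>S\<in>\<T>. {v. v extreme_point_of S})"
    by (auto simp: vertices_of_def)
  moreover have "finite {v. v extreme_point_of S}" if "S \<in> \<T>" for S
    using assms that by (metis aff_independent_finite simplex_extreme_points(1) triangulation_def)
  ultimately show ?thesis
    using assms by (simp add: triangulation_def)
qed

text \<open>A function \<open>\<omega>\<close> that supports every simplex of a triangulation induces no further cells,
  because the simplices already cover the polytope.\<close>

lemma regular_triangulationI:
  assumes T: "triangulation_of \<T> P" and "P \<noteq> {}"
    and supp: "\<And>S. S \<in> \<T> \<Longrightarrow> \<exists>c b. (\<forall>v\<in>vertices_of \<T>. c \<bullet> v + b \<le> \<omega> v) \<and>
      contact_set (vertices_of \<T>) \<omega> c b = {v. v extreme_point_of S}"
  shows "regular_triangulation \<T>"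
proof -
  let ?V = "vertices_of \<T>"
  have tri: "triangulation \<T>" and UT: "\<Union>\<T> = P" and "polytope P"
    and simp: "\<And>S. S \<in> \<T> \<Longrightarrow> aff_dim P simplex S"
    using T by (auto simp: triangulation_of_def)
  have "\<T> = {convex hull contact_set ?V \<omega> c b | c b.
      (\<forall>v\<in>?V. c \<bullet> v + b \<le> \<omega> v) \<and> aff_dim (contact_set ?V \<omega> c b) = aff_dim (\<Union>\<T>)}"
    (is "_ = ?R")
  proof (intro subset_antisym subsetI)
    fix S assume S: "S \<in> \<T>"
    obtain c b where cb: "\<forall>v\<in>?V. c \<bullet> v + b \<le> \<omega> v" "contact_set ?V \<omega> c b = {v. v extreme_point_of S}"
      using supp[OF S] by blast
    then have "S = convex hull contact_set ?V \<omega> c b" "aff_dim (contact_set ?V \<omega> c b) = aff_dim (\<Union>\<T>)"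
      using simplex_extreme_points[OF simp[OF S]] UT by simp_all
    with cb show "S \<in> ?R"
      by blast
  next
    fix X assume "X \<in> ?R"
    then obtain c b where cb: "\<And>v. v \<in> ?V \<Longrightarrow> c \<bullet> v + b \<le> \<omega> v"
      "aff_dim (contact_set ?V \<omega> c b) = aff_dim P" "X = convex hull contact_set ?V \<omega> c b"
      using UT by blast
    let ?A = "contact_set ?V \<omega> c b"
    \<comment> \<open>The empty set has dimension -1, so a nonempty \<open>P\<close> forces contact
      points.\<close>
    have "?A \<noteq> {}"
      using cb(2) \<open>P \<noteq> {}\<close> by (metis aff_dim_empty)
    then obtain p where p: "p \<in> rel_interior (convex hull ?A)"
      by (metis convex_convex_hull convex_hull_eq_empty ex_in_conv rel_interior_eq_empty)
    have "?V \<subseteq> P"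
      using UT by (auto simp: vertices_of_def extreme_point_of_def)
    then have "convex hull ?A \<subseteq> P"
      using \<open>polytope P\<close> by (intro hull_minimal) (auto simp: contact_set_def polytope_imp_convex)
    then obtain S where S: "S \<in> \<T>" "p \<in> S"
      using p UT rel_interior_subset by blast
    obtain c' b' where c': "\<And>v. v \<in> ?V \<Longrightarrow> c' \<bullet> v + b' \<le> \<omega> v"
      "contact_set ?V \<omega> c' b' = {v. v extreme_point_of S}"
      using supp[OF S(1)] by blast
    note ext = simplex_extreme_points[OF simp[OF S(1)]]
    \<comment> \<open>\<open>S\<close> contains a relative interior point of the cell, so the
      contact points of the cell are among those of \<open>S\<close>.\<close>
    have "?A \<subseteq> {v. v extreme_point_of S}"
      using contact_set_subset[of ?V c' b' \<omega> c b p] c' cb(1) p S(2) ext(2) by simp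
    \<comment> \<open>Affinely independent sets of equal dimension have equally many points; the
      dimension condition on cells enters here.\<close>
    moreover have "card ?A = card {v. v extreme_point_of S}"
      using aff_dim_affine_independent[OF affine_independent_subset[OF ext(1) calculation]]
        aff_dim_affine_independent[OF ext(1)] ext(3) cb(2) by linarith
    ultimately have "?A = {v. v extreme_point_of S}"
      by (simp add: aff_independent_finite card_subset_eq ext(1))
    then show "X \<in> \<T>"
      using cb(3) ext(2) S(1) by simp
  qed
  then show ?thesis
    using regular_triangulation_iff_contact_sets finite_vertices_of tri by blast
qed

text \<open>Chooses one supporting affine function per simplex. Its contact points are vertices of
  the triangulation lying in the simplex, hence extreme points of it; conversely, extreme points of
  a hull are among the generators.\<close>

lemma regular_triangulationE:
  assumes "regular_triangulation \<T>" and tri: "triangulation \<T>"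
  obtains \<omega> c b where
    "\<And>S v. S \<in> \<T> \<Longrightarrow> v \<in> vertices_of \<T> \<Longrightarrow> c S \<bullet> v + b S \<le> \<omega> v"
    "\<And>S. S \<in> \<T> \<Longrightarrow> contact_set (vertices_of \<T>) \<omega> (c S) (b S) = {v. v extreme_point_of S}"
proof -
  let ?V = "vertices_of \<T>"
  obtain \<omega> where \<omega>: "\<T> = {convex hull contact_set ?V \<omega> c b | c b.
      (\<forall>v\<in>?V. c \<bullet> v + b \<le> \<omega> v) \<and> aff_dim (contact_set ?V \<omega> c b) = aff_dim (\<Union>\<T>)}"
    using assms regular_triangulation_iff_contact_sets finite_vertices_of by blast
  have "\<exists>c b. (\<forall>v\<in>?V. c \<bullet> v + b \<le> \<omega> v) \<and> contact_set ?V \<omega> c b = {v. v extreme_point_of S}"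
    if S: "S \<in> \<T>" for S
  proof -
    obtain c b where cb: "\<forall>v\<in>?V. c \<bullet> v + b \<le> \<omega> v" "S = convex hull contact_set ?V \<omega> c b"
      using S \<omega> by blast
    have "{v. v extreme_point_of S} \<subseteq> contact_set ?V \<omega> c b"
      unfolding cb(2) using extreme_point_of_convex_hull by blast
    moreover have "contact_set ?V \<omega> c b \<subseteq> ?V \<inter> S"
      unfolding cb(2) by (auto simp: contact_set_def hull_inc)
    ultimately show ?thesis
      using cb(1) vertices_of_Int_simplex[OF tri S] by blast
  qed
  then show ?thesis
    using that[of _ _ \<omega>] by metis
qed

section \<open>Heights on all orthants\<close>

text \<open>The right side minus the left side is the sum of the products of
  \<open>c $ i + K\<close> and \<open>\<bar>u $ i\<bar> - u $ i\<close>. As \<open>c $ i + K\<close>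
  is positive, each product is nonnegative and vanishes only for nonnegative
  \<open>u $ i\<close>.\<close>

lemma fold_penalty:
  fixes c u :: "real ^ 'n"
  assumes "\<And>i. \<bar>c $ i\<bar> < K"
  shows "c \<bullet> u + K * (\<Sum>i\<in>UNIV. u $ i) \<le> c \<bullet> abs_vec u + K * (\<Sum>i\<in>UNIV. \<bar>u $ i\<bar>)"
    and "c \<bullet> u + K * (\<Sum>i\<in>UNIV. u $ i) = c \<bullet> abs_vec u + K * (\<Sum>i\<in>UNIV. \<bar>u $ i\<bar>) \<Longrightarrow>
      abs_vec u = u"
proof -
  have pos: "c $ i + K > 0" for i
    using assms[of i] by linarith
  have diff: "c \<bullet> abs_vec u + K * (\<Sum>i\<in>UNIV. \<bar>u $ i\<bar>) - (c \<bullet> u + K * (\<Sum>i\<in>UNIV. u $ i)) =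
      (\<Sum>i\<in>UNIV. (c $ i + K) * (\<bar>u $ i\<bar> - u $ i))"
    by (simp add: inner_vec_def sum_distrib_left algebra_simps sum.distrib sum_subtractf)
  have nonneg: "0 \<le> (c $ i + K) * (\<bar>u $ i\<bar> - u $ i)" for i
    using pos[of i] by simp
  then show "c \<bullet> u + K * (\<Sum>i\<in>UNIV. u $ i) \<le> c \<bullet> abs_vec u + K * (\<Sum>i\<in>UNIV. \<bar>u $ i\<bar>)"
    using diff sum_nonneg[of UNIV "\<lambda>i. (c $ i + K) * (\<bar>u $ i\<bar> - u $ i)"] by simp
  assume "c \<bullet> u + K * (\<Sum>i\<in>UNIV. u $ i) = c \<bullet> abs_vec u + K * (\<Sum>i\<in>UNIV. \<bar>u $ i\<bar>)"
  then have "\<forall>i. (c $ i + K) * (\<bar>u $ i\<bar> - u $ i) = 0"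
    using diff nonneg by (simp add: sum_nonneg_eq_0_iff)
  then show "abs_vec u = u"
    using pos by (auto simp: vec_eq_iff less_irrefl) (metis less_irrefl pos)
qed

text \<open>The simplex \<sigma>S is supported by the affine function of \<open>S\<close>, tilted by
  \<open>K\<close> in every coordinate and reflected by \<sigma>; \<open>fold_penalty\<close> keeps
  it strictly below the new heights at vertices outside the orthant of \<sigma>.\<close>

lemma regular_unconditional_family:
  assumes P: "anti_blocking P" and T: "triangulation_of \<T> P" and reg: "regular_triangulation \<T>"
  shows "regular_triangulation (unconditional_family \<T>)"
proof (cases "P = {}")
  case True
  \<comment> \<open>The criterion \<open>regular_triangulationI\<close> assumes a nonempty polytope.
    Here every simplex is empty, so reflecting changes nothing.\<close>
  then have "S = {}" if "S \<in> \<T>" for S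
    using T that by (auto simp: triangulation_of_def)
  then have "unconditional_family \<T> = \<T>"
    unfolding unconditional_family_def using one_in_sign_vectors by fastforce
  then show ?thesis
    using reg by simp
next
  case False
  have tri: "triangulation \<T>" and UT: "\<Union>\<T> = P"
    using T by (auto simp: triangulation_of_def)
  have fixed: "abs_vec p = p" if "p \<in> P" for p
    using P that by (intro abs_vec_of_nonneg) (simp add: anti_blocking_def)
  have VP: "vertices_of \<T> \<subseteq> P"
    using UT by (auto simp: vertices_of_def extreme_point_of_def)
  obtain \<omega> c b where
    le: "\<And>S v. S \<in> \<T> \<Longrightarrow> v \<in> vertices_of \<T> \<Longrightarrow> c S \<bullet> v + b S \<le> \<omega> v" and
    eq: "\<And>S. S \<in> \<T> \<Longrightarrow> contact_set (vertices_of \<T>) \<omega> (c S) (b S) = {v. v extreme_point_of S}"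
    using regular_triangulationE[OF reg tri] by metis
  \<comment> \<open>The sum dominates every coordinate of every \<open>c S\<close>; the extra 1
    makes the bound strict, as \<open>fold_penalty\<close> requires.\<close>
  define K where "K = 1 + (\<Sum>S\<in>\<T>. norm (c S))"
  have K: "\<bar>c S $ i\<bar> < K" if "S \<in> \<T>" for S i
  proof -
    have "\<bar>c S $ i\<bar> \<le> norm (c S)"
      by (rule component_le_norm_cart)
    also have "\<dots> \<le> (\<Sum>S\<in>\<T>. norm (c S))"
      using tri that by (intro member_le_sum) (auto simp: triangulation_def)
    finally show ?thesis
      by (simp add: K_def)
  qed
  define \<omega>' where "\<omega>' v = \<omega> (abs_vec v) + K * (\<Sum>i\<in>UNIV. \<bar>v $ i\<bar>)" for v
  let ?V = "vertices_of (unconditional_family \<T>)"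
  have V: "v \<in> ?V \<longleftrightarrow> abs_vec v \<in> vertices_of \<T>" for v
    unfolding vertices_of_unconditional_family
    by (metis VP abs_vec_sign_act fixed sign_act_signs_of_self signs_of_in_sign_vectors subsetD)
  show ?thesis
  proof (rule regular_triangulationI[OF triangulation_of_unconditional[OF P T]])
    show "unconditional P \<noteq> {}"
      using False fixed unconditional_iff by (metis ex_in_conv)
    fix X assume "X \<in> unconditional_family \<T>"
    then obtain \<sigma> S where \<sigma>: "\<sigma> \<in> sign_vectors" and S: "S \<in> \<T>" and X: "X = sign_act \<sigma> ` S"
      by (rule unconditional_familyE)
    \<comment> \<open>On the orthant of \<sigma> the penalty is linear, namely \<open>K\<close>
      times the sum of the reflected coordinates; this adds \<open>K\<close> to each coordinate of
      \<open>c S\<close>.\<close>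
    define c' where "c' = sign_act \<sigma> (c S + (\<chi> i. K))"
    have c': "c' \<bullet> v + b S = (c S \<bullet> sign_act \<sigma> v + K * (\<Sum>i\<in>UNIV. sign_act \<sigma> v $ i)) + b S" for v
      unfolding c'_def inner_sign_act inner_add_left
      by (simp add: inner_vec_def sum_distrib_left)
    have \<omega>': "\<omega>' v = \<omega> (abs_vec (sign_act \<sigma> v)) + K * (\<Sum>i\<in>UNIV. \<bar>sign_act \<sigma> v $ i\<bar>)" for v
    proof -
      have "\<bar>sign_act \<sigma> v $ i\<bar> = \<bar>v $ i\<bar>" for i
        using abs_vec_sign_act[OF \<sigma>, of v] unfolding vec_eq_iff abs_vec_nth by blast
      then show ?thesis
        unfolding \<omega>'_def by (simp only: abs_vec_sign_act[OF \<sigma>])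
    qed
    have V\<sigma>: "v \<in> ?V \<longleftrightarrow> abs_vec (sign_act \<sigma> v) \<in> vertices_of \<T>" for v
      by (simp add: V abs_vec_sign_act[OF \<sigma>])
    have below: "c' \<bullet> v + b S \<le> \<omega>' v" if "v \<in> ?V" for v
      using fold_penalty(1)[OF K[OF S], of "sign_act \<sigma> v"] le[OF S, of "abs_vec (sign_act \<sigma> v)"] that
      unfolding c' \<omega>' V\<sigma> by linarith
    have "contact_set ?V \<omega>' c' (b S) = {v. v extreme_point_of X}"
    proof (intro set_eqI iffI)
      fix v assume "v \<in> contact_set ?V \<omega>' c' (b S)"
      then have v: "abs_vec (sign_act \<sigma> v) \<in> vertices_of \<T>" "c' \<bullet> v + b S = \<omega>' v"
        by (auto simp: contact_set_def V\<sigma>)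
      let ?u = "sign_act \<sigma> v"
      \<comment> \<open>The fold inequality and the support inequality of \<open>S\<close> add up to
        an equality, so both are tight. The first puts \<open>?u\<close> into the nonnegative
        orthant, the second makes it a contact point.\<close>
      have "c S \<bullet> ?u + K * (\<Sum>i\<in>UNIV. ?u $ i) = c S \<bullet> abs_vec ?u + K * (\<Sum>i\<in>UNIV. \<bar>?u $ i\<bar>)"
        and touch: "c S \<bullet> abs_vec ?u + b S = \<omega> (abs_vec ?u)"
        using fold_penalty(1)[OF K[OF S], of ?u] le[OF S v(1)] v(2) unfolding c' \<omega>' by linarith+
      then have "abs_vec ?u = ?u"
        using fold_penalty(2)[OF K[OF S]] by blast
      then have "?u \<in> contact_set (vertices_of \<T>) \<omega> (c S) (b S)"
        using touch v(1) by (simp add: contact_set_def)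
      then show "v \<in> {v. v extreme_point_of X}"
        using eq[OF S] by (simp add: X extreme_point_of_sign_act_image[OF \<sigma>])
    next
      fix v assume "v \<in> {v. v extreme_point_of X}"
      then have "sign_act \<sigma> v \<in> contact_set (vertices_of \<T>) \<omega> (c S) (b S)"
        using eq[OF S] by (simp add: X extreme_point_of_sign_act_image[OF \<sigma>])
      then have u: "sign_act \<sigma> v \<in> vertices_of \<T>"
        "c S \<bullet> sign_act \<sigma> v + b S = \<omega> (sign_act \<sigma> v)"
        by (auto simp: contact_set_def)
      have abs_u: "abs_vec (sign_act \<sigma> v) = sign_act \<sigma> v"
        using u(1) VP fixed by blast
      then have "\<bar>sign_act \<sigma> v $ i\<bar> = sign_act \<sigma> v $ i" for i
        by (metis abs_vec_nth)
      then show "v \<in> contact_set ?V \<omega>' c' (b S)"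
        using u by (simp only: contact_set_def mem_Collect_eq V\<sigma> c' \<omega>' abs_u simp_thms)
    qed
    with below show "\<exists>c b. (\<forall>v\<in>?V. c \<bullet> v + b \<le> \<omega>' v) \<and>
        contact_set ?V \<omega>' c b = {v. v extreme_point_of X}"
      by blast
  qed
qed

section \<open>Flagness\<close>

text \<open>The family is invariant under \<sigma>: pulling a face of \<tau>S back by \<sigma> gives
  a face of the simplex reflected by the product of both sign vectors.\<close>

lemma non_face_sign_act_image:
  assumes \<sigma>: "\<sigma> \<in> sign_vectors" and nf: "non_face (unconditional_family \<T>) W"
  shows "non_face (unconditional_family \<T>) (sign_act \<sigma> ` W)"
  unfolding non_face_def
proof (intro conjI notI)
  show "sign_act \<sigma> ` W \<subseteq> vertices_of (unconditional_family \<T>)"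
    using nf sign_act_vertices_of_unconditional_family[OF \<sigma>] by (auto simp: non_face_def)
next
  assume "\<exists>X\<in>unconditional_family \<T>. convex hull (sign_act \<sigma> ` W) face_of X"
  then obtain \<tau> S where \<tau>: "\<tau> \<in> sign_vectors" "S \<in> \<T>"
    and face: "convex hull (sign_act \<sigma> ` W) face_of sign_act \<tau> ` S"
    by (metis unconditional_familyE)
  have "sign_act \<tau> ` S = sign_act \<sigma> ` sign_act (sign_act \<sigma> \<tau>) ` S"
    by (simp add: image_image sign_act_involutive[OF \<sigma>] flip: sign_act_assoc)
  with face have "convex hull W face_of sign_act (sign_act \<sigma> \<tau>) ` S"
    by (simp add: face_of_linear_image[OF linear_sign_act inj_sign_act[OF \<sigma>]]
        flip: convex_hull_linear_image[OF linear_sign_act])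
  then show False
    using nf \<sigma> \<tau> sign_act_in_sign_vectors unconditional_familyI unfolding non_face_def by blast
qed

text \<open>If the hull of a nonnegative set \<open>W\<close> is a face of \<sigma>S, then \<sigma>
  fixes \<open>W\<close> pointwise, so the hull is already a face of \<open>S\<close>.\<close>

lemma non_face_unconditional_family_iff:
  assumes pos: "\<And>p i. p \<in> \<Union>\<T> \<Longrightarrow> 0 \<le> p $ i" and W: "\<And>w i. w \<in> W \<Longrightarrow> 0 \<le> w $ i"
  shows "non_face (unconditional_family \<T>) W \<longleftrightarrow> non_face \<T> W"
proof -
  have in_S: "sign_act \<sigma> w = w" if "\<sigma> \<in> sign_vectors" "w \<in> W" "S \<in> \<T>" "sign_act \<sigma> w \<in> S" for \<sigma> w S
    using that pos W by (intro sign_act_fixed) blast+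
  have "w \<in> vertices_of (unconditional_family \<T>) \<longleftrightarrow> w \<in> vertices_of \<T>" if "w \<in> W" for w
  proof
    assume "w \<in> vertices_of (unconditional_family \<T>)"
    then obtain \<sigma> S where "\<sigma> \<in> sign_vectors" "S \<in> \<T>" "sign_act \<sigma> w extreme_point_of S"
      unfolding vertices_of_unconditional_family by (auto simp: vertices_of_def)
    then show "w \<in> vertices_of \<T>"
      using in_S[of \<sigma> w S] that by (auto simp: vertices_of_def extreme_point_of_def)
  next
    assume "w \<in> vertices_of \<T>"
    then show "w \<in> vertices_of (unconditional_family \<T>)"
      unfolding vertices_of_unconditional_family
      by (intro bexI[OF _ one_in_sign_vectors]) (simp add: sign_act_one)
  qed
  moreover have "(\<exists>X\<in>unconditional_family \<T>. convex hull W face_of X) \<longleftrightarrow>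
      (\<exists>S\<in>\<T>. convex hull W face_of S)"
  proof
    assume "\<exists>X\<in>unconditional_family \<T>. convex hull W face_of X"
    then obtain \<sigma> S where \<sigma>: "\<sigma> \<in> sign_vectors" "S \<in> \<T>"
      and face: "convex hull W face_of sign_act \<sigma> ` S"
      by (metis unconditional_familyE)
    have "sign_act \<sigma> w = w" if "w \<in> W" for w
    proof (rule in_S[OF \<sigma>(1) that \<sigma>(2)])
      have "w \<in> sign_act \<sigma> ` S"
        using face_of_imp_subset[OF face] that by (meson hull_inc subsetD)
      then show "sign_act \<sigma> w \<in> S"
        by (simp add: mem_sign_act_image_iff[OF \<sigma>(1)])
    qed
    then have "sign_act \<sigma> ` W = W"
      by simp
    then have "convex hull W = sign_act \<sigma> ` (convex hull W)"
      by (simp add: convex_hull_linear_image[OF linear_sign_act])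
    then have "convex hull W face_of S"
      using face face_of_linear_image[OF linear_sign_act inj_sign_act[OF \<sigma>(1)]] by metis
    then show "\<exists>S\<in>\<T>. convex hull W face_of S"
      using \<sigma> by blast
  next
    assume "\<exists>S\<in>\<T>. convex hull W face_of S"
    then obtain S where "S \<in> \<T>" "convex hull W face_of S"
      by blast
    then show "\<exists>X\<in>unconditional_family \<T>. convex hull W face_of X"
      using unconditional_familyI[OF one_in_sign_vectors, of S \<T>] by (auto simp: sign_act_one)
  qed
  ultimately show ?thesis
    unfolding non_face_def by blast
qed

text \<open>By contradiction: a minimal non-face of cardinality other than 2 is reflected into the
  nonnegative orthant, where it is a minimal non-face of \<T>; flagness of \<T> then gives it two
  elements.\<close>

lemma flag_unconditional_family:
  fixes \<T> :: "(real ^ 'n) set set"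
  assumes pos: "\<And>p i. p \<in> \<Union>\<T> \<Longrightarrow> 0 \<le> p $ i" and flag: "flag_triangulation \<T>"
  shows "flag_triangulation (unconditional_family \<T>)"
  unfolding flag_triangulation_def
proof (intro allI impI, elim conjE, rule ccontr)
  fix W :: "(real ^ 'n) set"
  assume nf: "non_face (unconditional_family \<T>) W"
    and minimal: "\<forall>W'. W' \<subset> W \<longrightarrow> \<not> non_face (unconditional_family \<T>) W'"
    and card: "card W \<noteq> 2"
  have same_sign: "0 \<le> v $ i * w $ i" if vw: "v \<in> W" "w \<in> W" for v w i
  proof (cases "v = w")
    case False
    \<comment> \<open>As \<open>W\<close> does not have two elements, the pair is a proper subset,
      and minimality makes it a face.\<close>
    then have "{v, w} \<subset> W"
      using vw card by (metis card_2_iff empty_subsetI insert_subset psubsetI)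
    then have "\<not> non_face (unconditional_family \<T>) {v, w}"
      using minimal by blast
    moreover have "{v, w} \<subseteq> vertices_of (unconditional_family \<T>)"
      using nf vw by (auto simp: non_face_def)
    ultimately obtain X where X: "X \<in> unconditional_family \<T>" "convex hull {v, w} face_of X"
      by (auto simp: non_face_def)
    then obtain \<sigma> S where \<sigma>: "\<sigma> \<in> sign_vectors" "S \<in> \<T>" "X = sign_act \<sigma> ` S"
      by (metis unconditional_familyE)
    have "{v, w} \<subseteq> X"
      using X(2) face_of_imp_subset hull_subset by (metis subset_trans)
    then have "sign_act \<sigma> v \<in> S" "sign_act \<sigma> w \<in> S"
      using \<sigma> by (simp_all add: mem_sign_act_image_iff)
    then have "0 \<le> \<sigma> $ i * v $ i" "0 \<le> \<sigma> $ i * w $ i"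
      using pos \<sigma>(2) sign_act_nth by (metis UnionI)+
    then show ?thesis
      using sign_vectors_cases[OF \<sigma>(1), of i] by (auto simp: mult_nonneg_nonneg mult_nonpos_nonpos)
  qed simp
  \<comment> \<open>Flips the coordinates in which some point of \<open>W\<close> is negative; by
    \<open>same_sign\<close> no point of \<open>W\<close> is positive there.\<close>
  define \<sigma> :: "real ^ 'n" where "\<sigma> = (\<chi> i. if \<exists>w\<in>W. w $ i < 0 then - 1 else 1)"
  have \<sigma>: "\<sigma> \<in> sign_vectors"
    by (simp add: \<sigma>_def sign_vectors_def)
  have \<sigma>_pos: "0 \<le> w $ i" if "w \<in> sign_act \<sigma> ` W" for w i
  proof -
    obtain v where v: "v \<in> W" "w = sign_act \<sigma> v"
      using \<open>w \<in> sign_act \<sigma> ` W\<close> by blast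
    show ?thesis
    proof (cases "\<exists>u\<in>W. u $ i < 0")
      case True
      then obtain u where "u \<in> W" "u $ i < 0"
        by blast
      then have "v $ i \<le> 0"
        using same_sign[OF v(1), of u i] by (auto simp: zero_le_mult_iff)
      then show ?thesis
        using True v by (simp add: \<sigma>_def)
    next
      case False
      then show ?thesis
        using v by (auto simp: \<sigma>_def not_less)
    qed
  qed
  have "non_face \<T> (sign_act \<sigma> ` W)"
    using non_face_sign_act_image[OF \<sigma> nf] pos \<sigma>_pos non_face_unconditional_family_iff by metis
  \<comment> \<open>Minimality carries over because reflecting \<open>W'\<close> back gives a proper
    subset of \<open>W\<close>.\<close>
  moreover have "\<not> non_face \<T> W'" if W': "W' \<subset> sign_act \<sigma> ` W" for W'
  proof
    assume "non_face \<T> W'"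
    then have "non_face (unconditional_family \<T>) W'"
      using pos \<sigma>_pos W' non_face_unconditional_family_iff by (metis psubsetE subsetD)
    then have "non_face (unconditional_family \<T>) (sign_act \<sigma> ` W')"
      by (rule non_face_sign_act_image[OF \<sigma>])
    moreover have "sign_act \<sigma> ` W' \<subset> W"
      using W' by (metis \<sigma> inj_sign_act image_strict_mono inj_on_subset sign_act_image_involutive subset_UNIV)
    ultimately show False
      using minimal by blast
  qed
  ultimately have "card (sign_act \<sigma> ` W) = 2"
    using flag unfolding flag_triangulation_def by blast
  then show False
    using card inj_sign_act[OF \<sigma>] by (simp add: card_image inj_on_subset)
qed

theorem theorem3p2:
  fixes P :: "(real ^ 'n) set" and \<T> :: "(real ^ 'n) set set"
  assumes "anti_blocking P"
    and "triangulation_of \<T> P"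
  shows "triangulation_of (unconditional_family \<T>) (unconditional P) \<and>
    (unimodular_triangulation \<T> \<longrightarrow> unimodular_triangulation (unconditional_family \<T>)) \<and>
    (regular_triangulation \<T> \<longrightarrow> regular_triangulation (unconditional_family \<T>)) \<and>
    (flag_triangulation \<T> \<longrightarrow> flag_triangulation (unconditional_family \<T>))"
proof -
  have pos: "0 \<le> p $ i" if "p \<in> \<Union>\<T>" for p i
    using assms that by (auto simp: triangulation_of_def anti_blocking_def)
  show ?thesis
    by (intro conjI impI triangulation_of_unconditional[OF assms]
        regular_unconditional_family[OF assms] unimodular_unconditional_family
        flag_unconditional_family pos)
qed

end
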